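(* Let $n\ge 2$, let $0<w_1<\dots<w_n$ be real numbers, let $H_1,\dots,H_n$ be non-zero complex constants, and let $$f(z)=1+H_1e^{w_1z}+\cdots+H_ne^{w_nz},\qquad z\in\mathbb{C}.$$ Let $\{z_m\}_{m\ge 1}$ denote the sequence of zeros of $f$, listed according to multiplicities and ordered with respect to increasing modulus. For each $m$ let $$D_m=\{z\in\mathbb{C}: |z-z_m|<r_m\},\qquad r_m=\frac{1}{(1+|z_m|)\,\bigl(\log(e+|z_m|)\bigr)^{2}}.$$ Then the set $C\subset\mathbb{R}$ of values $c$ for which the vertical line $\operatorname{Re}(z)=c$ meets infinitely many of the discs $D_m$ has linear (one-dimensional Lebesgue) measure zero. *)

theory Defs
  imports "HOL-Complex_Analysis.Complex_Analysis"
begin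

definition exp_sum :: "nat \<Rightarrow> (nat \<Rightarrow> complex) \<Rightarrow> (nat \<Rightarrow> real) \<Rightarrow> complex \<Rightarrow> complex" where
  "exp_sum n H w z = 1 + (\<Sum>k=1..n. H k * exp (complex_of_real (w k) * z))"

text \<open>
  The terms of the sequence are \<open>z 1, z 2, \<dots>\<close>; the value \<open>z 0\<close> plays no role.
  Finiteness is required separately because \<open>card\<close> of an infinite set is 0.
\<close>
definition zero_sequence :: "(complex \<Rightarrow> complex) \<Rightarrow> (nat \<Rightarrow> complex) \<Rightarrow> bool" where
  "zero_sequence f z \<longleftrightarrow>
     z ` {1..} = {u. f u = 0} \<and>
     (\<forall>u. f u = 0 \<longrightarrow>
        finite {m\<in>{1..}. z m = u} \<and> int (card {m\<in>{1..}. z m = u}) = zorder f u) \<and>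
     mono_on {1..} (\<lambda>m. cmod (z m))"

definition disc_radius :: "complex \<Rightarrow> real" where
  "disc_radius u = 1 / ((1 + cmod u) * (ln (exp 1 + cmod u))\<^sup>2)"

definition zero_disc :: "(nat \<Rightarrow> complex) \<Rightarrow> nat \<Rightarrow> complex set" where
  "zero_disc z m = ball (z m) (disc_radius (z m))"

definition vertical_line :: "real \<Rightarrow> complex set" where
  "vertical_line c = {u. Re u = c}"

end

theory Submission
  imports Defs "HOL-Real_Asymp.Real_Asymp"
begin

text \<open>
  The line \<open>Re z = c\<close> meets the disc \<open>D\<^sub>m\<close> exactly when \<open>c\<close> lies in an open interval of
  length \<open>2 r\<^sub>m\<close>, so by Borel--Cantelli it is enough that the radii \<open>r\<^sub>m\<close> have a finite sum.

  For this the zeros must not be too dense: \<open>f\<close> is an entire function of exponential type, and such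
  a function, if not identically zero, has only \<open>O(R)\<close> zeros in a disc of radius \<open>R\<close>. As the zeros are ordered by modulus, this
  says that \<open>\<bar>z\<^sub>m\<bar> \<ge> c m\<close> for some \<open>c > 0\<close> and all large \<open>m\<close> (lemma \<open>linear_growth_of_zeros\<close>).
  Hence \<open>r\<^sub>m\<close> is dominated by the Bertrand series with terms of order \<open>1 / (m (log m)\<^sup>2)\<close>, which
  converges (lemma \<open>summable_disc_radius\<close>).

  The zero count rests on a weak form of Jensen's formula: divide \<open>f\<close> by the linear factors of \<open>m\<close> of
  its zeros and compare the quotient at the centre of a disc with its size on the boundary of the disc
  of three times the radius. Each factor gains a 2, so \<open>2\<^sup>m \<bar>f a\<bar>\<close> is at most the maximum of
  \<open>\<bar>f\<bar>\<close> on the large disc (lemma \<open>zero_count_bound\<close>).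
\<close>

section \<open>Counting the zeros of an entire function\<close>

text \<open>
  The induction peels off one zero at a time. The point to check is that the quotient \<open>g\<close> still
  vanishes at the next listed zero \<open>u\<close>: otherwise the order of \<open>f\<close> at \<open>u\<close> would be the
  number of factors already removed at \<open>u\<close>, which is less than the number of times \<open>u\<close> is listed.
\<close>
lemma factor_out_zeros:
  assumes f: "f holomorphic_on UNIV" and z: "zero_sequence f z"
    and "finite J" "J \<subseteq> {1..}"
  shows "\<exists>g. g holomorphic_on UNIV \<and> (\<forall>u. f u = g u * (\<Prod>j\<in>J. u - z j))"
  using assms(3,4)
proof (induction J rule: finite_induct)
  case empty
  then show ?case using f by (intro exI[of _ f]) auto
next
  case (insert i J)
  then obtain g where g: "g holomorphic_on UNIV" "\<And>u. f u = g u * (\<Prod>j\<in>J. u - z j)"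
    by auto
  define u where "u = z i"
  have i: "i \<in> {1..}" using insert.prems by auto
  have fu: "f u = 0" using z i unfolding zero_sequence_def u_def by blast
  have gu: "g u = 0"
  proof (rule ccontr)
    assume gu: "g u \<noteq> 0"
    define A where "A = {j\<in>J. z j = u}"
    define B where "B = {j\<in>J. z j \<noteq> u}"
    have AB: "finite A" "finite B" "A \<inter> B = {}" "J = A \<union> B"
      using insert.hyps by (auto simp: A_def B_def)
    have "zorder f u = int (card A)"
    proof (rule zorder_eqI[where S = UNIV and g = "\<lambda>v. g v * (\<Prod>j\<in>B. v - z j)"])
      show "(\<lambda>v. g v * (\<Prod>j\<in>B. v - z j)) holomorphic_on UNIV"
        by (intro holomorphic_intros g)
      show "g u * (\<Prod>j\<in>B. u - z j) \<noteq> 0"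
        using gu AB(2) by (auto simp: B_def)
      show "f v = g v * (\<Prod>j\<in>B. v - z j) * (v - u) powi int (card A)" for v
      proof -
        have "(\<Prod>j\<in>A. v - z j) = (\<Prod>j\<in>A. v - u)"
          by (intro prod.cong) (auto simp: A_def)
        then show ?thesis
          using prod.union_disjoint[OF AB(1-3), of "\<lambda>j. v - z j"] by (simp add: g(2) AB(4))
      qed
    qed auto
    moreover have fin: "finite {m\<in>{1..}. z m = u}" and "int (card {m\<in>{1..}. z m = u}) = zorder f u"
      using z fu unfolding zero_sequence_def by blast+
    moreover have "A \<subset> {m\<in>{1..}. z m = u}"
      using insert.prems insert.hyps by (auto simp: A_def u_def)
    then have "card A < card {m\<in>{1..}. z m = u}"
      by (rule psubset_card_mono[OF fin])
    ultimately show False by linarith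
  qed
  define h where "h = (\<lambda>v. if v = u then deriv g u else (g v - g u) / (v - u))"
  have "h holomorphic_on UNIV"
    unfolding h_def by (rule pole_lemma_open[OF g(1)]) auto
  moreover have "g v = h v * (v - u)" for v
    using gu by (auto simp: h_def)
  ultimately show ?case
    using insert.hyps g(2) by (intro exI[of _ h]) (auto simp: u_def mult.assoc)
qed

text \<open>
  On the circle of radius \<open>3 \<rho>\<close> about \<open>a\<close> every factor \<open>u - z j\<close> is at least \<open>2 \<rho>\<close> in modulus,
  whereas at the centre \<open>a\<close> it is at most \<open>\<rho>\<close>.
\<close>
lemma zero_count_bound:
  assumes f: "f holomorphic_on UNIV" and z: "zero_sequence f z"
    and J: "finite J" "J \<subseteq> {1..}" and "\<rho> > 0"
    and near: "\<And>j. j \<in> J \<Longrightarrow> cmod (a - z j) \<le> \<rho>"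
    and M: "\<And>u. cmod (u - a) = 3 * \<rho> \<Longrightarrow> cmod (f u) \<le> M"
  shows "2 ^ card J * cmod (f a) \<le> M"
proof -
  obtain g where g: "g holomorphic_on UNIV" "\<And>u. f u = g u * (\<Prod>j\<in>J. u - z j)"
    using factor_out_zeros[OF f z J] by blast
  let ?m = "card J"
  have "cmod (g a) \<le> M / (2 * \<rho>) ^ ?m"
  proof (rule maximum_modulus_frontier[of g "cball a (3 * \<rho>)"])
    show "g holomorphic_on interior (cball a (3 * \<rho>))"
      using g(1) holomorphic_on_subset by blast
    show "continuous_on (closure (cball a (3 * \<rho>))) g"
      using g(1) holomorphic_on_imp_continuous_on continuous_on_subset by blast
    show "cmod (g u) \<le> M / (2 * \<rho>) ^ ?m" if "u \<in> frontier (cball a (3 * \<rho>))" for u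
    proof -
      have u: "cmod (u - a) = 3 * \<rho>"
        using that by (auto simp: dist_norm norm_minus_commute)
      have "2 * \<rho> \<le> cmod (u - z j)" if "j \<in> J" for j
      proof -
        have "cmod (u - a) \<le> cmod (u - z j) + cmod (a - z j)"
          using norm_triangle_ineq4[of "u - z j" "a - z j"] by simp
        then show ?thesis using u near[OF that] by linarith
      qed
      then have "(2 * \<rho>) ^ ?m \<le> (\<Prod>j\<in>J. cmod (u - z j))"
        using \<open>\<rho> > 0\<close> by (subst prod_constant[symmetric]) (intro prod_mono, auto)
      then have "cmod (g u) * (2 * \<rho>) ^ ?m \<le> cmod (f u)"
        by (simp add: g(2) norm_mult prod_norm[symmetric] mult_left_mono)
      also have "\<dots> \<le> M" by (rule M[OF u])
      finally show ?thesis using \<open>\<rho> > 0\<close> by (simp add: pos_le_divide_eq)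
    qed
  qed (use \<open>\<rho> > 0\<close> in auto)
  then have "cmod (g a) * (2 * \<rho>) ^ ?m \<le> M"
    using \<open>\<rho> > 0\<close> by (simp add: pos_le_divide_eq)
  moreover have "(\<Prod>j\<in>J. cmod (a - z j)) \<le> \<rho> ^ ?m"
    using near by (subst prod_constant[symmetric]) (intro prod_mono, auto)
  then have "cmod (f a) \<le> cmod (g a) * \<rho> ^ ?m"
    by (simp add: g(2) norm_mult prod_norm[symmetric] mult_left_mono)
  then have "2 ^ ?m * cmod (f a) \<le> 2 ^ ?m * (cmod (g a) * \<rho> ^ ?m)"
    by (rule mult_left_mono) simp
  moreover have "2 ^ ?m * (cmod (g a) * \<rho> ^ ?m) = cmod (g a) * (2 * \<rho>) ^ ?m"
    by (simp add: power_mult_distrib)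
  ultimately show ?thesis by linarith
qed

text \<open>
  By monotonicity of the moduli, the first \<open>m\<close> zeros all lie in the disc of radius
  \<open>\<bar>z m\<bar> + \<bar>a\<bar>\<close> about any point \<open>a\<close>. With \<open>f a \<noteq> 0\<close> the count of zeros bounds \<open>2\<^sup>m\<close>
  by an exponential in \<open>\<bar>z m\<bar>\<close>; taking logarithms gives the claim. The origin may itself be a zero,
  which is why the centre is arbitrary.
\<close>
lemma linear_growth_of_zeros:
  assumes f: "f holomorphic_on UNIV" and z: "zero_sequence f z" and a: "f a \<noteq> 0"
    and bound: "\<And>u. cmod (f u) \<le> C * exp (W * cmod u)" and "W > 0"
  shows "\<exists>c>0. eventually (\<lambda>m. c * real m \<le> cmod (z m)) sequentially"
proof -
  have mono: "mono_on {1..} (\<lambda>m. cmod (z m))"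
    using z unfolding zero_sequence_def by blast
  have "0 < cmod (f a)" using a by simp
  also have "\<dots> \<le> C * exp (W * cmod a)" by (rule bound)
  finally have "C > 0" by (simp add: zero_less_mult_iff)
  define A where "A = ln C - ln (cmod (f a)) + W * (4 * cmod a + 3)"
  have main: "real m * ln 2 \<le> A + 3 * W * cmod (z m)" if "m \<ge> 1" for m
  proof -
    define \<rho> where "\<rho> = cmod (z m) + cmod a + 1"
    have "\<rho> > 0" unfolding \<rho>_def by (smt (verit) norm_ge_zero)
    have "2 ^ card {1..m} * cmod (f a) \<le> C * exp (W * (cmod a + 3 * \<rho>))"
    proof (rule zero_count_bound[OF f z _ _ \<open>\<rho> > 0\<close>])
      show "cmod (a - z j) \<le> \<rho>" if "j \<in> {1..m}" for j
        using mono_onD[OF mono, of j m] that norm_triangle_ineq4[of a "z j"]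
        by (auto simp: \<rho>_def)
      show "cmod (f u) \<le> C * exp (W * (cmod a + 3 * \<rho>))" if "cmod (u - a) = 3 * \<rho>" for u
      proof -
        have "cmod u \<le> cmod a + 3 * \<rho>"
          using norm_triangle_ineq[of "u - a" a] that by simp
        then have "C * exp (W * cmod u) \<le> C * exp (W * (cmod a + 3 * \<rho>))"
          using \<open>C > 0\<close> \<open>W > 0\<close> by simp
        then show ?thesis using bound[of u] by linarith
      qed
    qed auto
    then have "ln (2 ^ m * cmod (f a)) \<le> ln (C * exp (W * (cmod a + 3 * \<rho>)))"
      using a \<open>C > 0\<close> by (subst ln_le_cancel_iff) auto
    then have "real m * ln 2 + ln (cmod (f a)) \<le> ln C + W * (cmod a + 3 * \<rho>)"
      using a \<open>C > 0\<close> by (simp add: ln_mult ln_realpow)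
    then show ?thesis by (simp add: A_def \<rho>_def algebra_simps)
  qed
  define c where "c = ln 2 / (6 * W)"
  have "c > 0" using \<open>W > 0\<close> by (simp add: c_def)
  moreover have "eventually (\<lambda>m. A \<le> real m * (ln 2 / 2)) sequentially"
    by real_asymp
  then have "eventually (\<lambda>m. c * real m \<le> cmod (z m)) sequentially"
    using eventually_ge_at_top[of 1]
  proof eventually_elim
    case (elim m)
    then have "real m * (ln 2 / 2) \<le> 3 * W * cmod (z m)"
      using main[of m] by (simp add: field_simps)
    then show ?case using \<open>W > 0\<close> by (simp add: c_def field_simps)
  qed
  ultimately show ?thesis by blast
qed

section \<open>Summability of the radii\<close>

lemma disc_radius_nonneg: "0 \<le> disc_radius u"
  unfolding disc_radius_def by simp

lemma disc_radius_antimono: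
  assumes "cmod u \<le> cmod v"
  shows "disc_radius v \<le> disc_radius u"
proof -
  have e: "ln (exp 1 + cmod u) \<ge> 1"
    by (subst ln_ge_iff) (auto intro: add_pos_nonneg)
  moreover have "ln (exp 1 + cmod u) \<le> ln (exp 1 + cmod v)"
    using assms by (subst ln_le_cancel_iff) (auto intro: add_pos_nonneg)
  ultimately have "(ln (exp 1 + cmod u))\<^sup>2 \<le> (ln (exp 1 + cmod v))\<^sup>2"
    by (intro power_mono) auto
  then show ?thesis
    unfolding disc_radius_def using assms e
    by (intro divide_left_mono mult_mono mult_pos_pos) (auto intro: add_pos_nonneg)
qed

text \<open>Condensation turns this Bertrand series into \<open>\<Sum> 1 / k\<^sup>2\<close> up to constants.\<close>
lemma summable_disc_radius:
  assumes "c > 0"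
  shows "summable (\<lambda>m. disc_radius (of_real (c * real m)))"
proof (subst condensation_test)
  show "disc_radius (of_real (c * real (Suc m))) \<le> disc_radius (of_real (c * real m))" for m
    using assms by (intro disc_radius_antimono) (simp add: abs_mult del: of_real_mult)
  have "(\<lambda>k. 2 ^ k * disc_radius (of_real (c * real (2 ^ k))))
      = (\<lambda>k. 2 ^ k * (1 / ((1 + c * 2 ^ k) * (ln (exp 1 + c * 2 ^ k))\<^sup>2)))"
    using assms by (simp add: disc_radius_def norm_mult norm_power)
  also have "\<dots> \<in> O(\<lambda>k. inverse (real k ^ 2))"
    using assms by real_asymp
  finally show "summable (\<lambda>k. 2 ^ k * disc_radius (of_real (c * real (2 ^ k))))"
    by (rule summable_comparison_test_bigo[rotated])
       (use inverse_power_summable[of 2, where 'a = real] in \<open>simp add: norm_power\<close>)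
qed (rule disc_radius_nonneg)

section \<open>Exponential sums\<close>

lemma exp_sum_holomorphic: "exp_sum n H w holomorphic_on UNIV"
  unfolding exp_sum_def[abs_def] by (intro holomorphic_intros)

lemma exp_sum_exponential_type:
  assumes "\<And>k. k \<in> {1..n} \<Longrightarrow> \<bar>w k\<bar> \<le> W" and "W \<ge> 0"
  shows "cmod (exp_sum n H w u) \<le> (1 + (\<Sum>k=1..n. cmod (H k))) * exp (W * cmod u)"
proof -
  have "cmod (H k * exp (of_real (w k) * u)) \<le> cmod (H k) * exp (W * cmod u)"
    if "k \<in> {1..n}" for k
  proof -
    have "w k * Re u \<le> \<bar>w k\<bar> * \<bar>Re u\<bar>" by (metis abs_ge_self abs_mult)
    also have "\<dots> \<le> W * cmod u"
      using assms that by (intro mult_mono abs_Re_le_cmod) auto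
    finally show ?thesis by (simp add: norm_mult mult_left_mono)
  qed
  then have "(\<Sum>k=1..n. cmod (H k * exp (of_real (w k) * u)))
      \<le> (\<Sum>k=1..n. cmod (H k) * exp (W * cmod u))"
    by (rule sum_mono)
  moreover have "cmod (exp_sum n H w u) \<le> 1 + (\<Sum>k=1..n. cmod (H k * exp (of_real (w k) * u)))"
    unfolding exp_sum_def by (rule norm_triangle_le) (simp add: norm_sum)
  moreover have "1 \<le> exp (W * cmod u)" using assms(2) by simp
  ultimately show ?thesis unfolding distrib_right sum_distrib_right by linarith
qed

lemma exp_sum_tendsto_1:
  assumes "\<And>k. k \<in> {1..n} \<Longrightarrow> w k > 0"
  shows "((\<lambda>x. exp_sum n H w (of_real x)) \<longlongrightarrow> 1) at_bot"
proof -
  have "((\<lambda>x. exp (complex_of_real (w k) * of_real x)) \<longlongrightarrow> 0) at_bot" if "k \<in> {1..n}" for k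
  proof (rule tendsto_norm_zero_cancel)
    have "((\<lambda>x. exp (w k * x)) \<longlongrightarrow> 0) at_bot"
      using assms[OF that] by real_asymp
    then show "((\<lambda>x. cmod (exp (complex_of_real (w k) * of_real x))) \<longlongrightarrow> 0) at_bot"
      by simp
  qed
  then have "((\<lambda>x. 1 + (\<Sum>k=1..n. H k * exp (complex_of_real (w k) * of_real x)))
      \<longlongrightarrow> 1 + (\<Sum>k=1..n. H k * 0)) at_bot"
    by (intro tendsto_intros) auto
  then show ?thesis by (simp add: exp_sum_def)
qed

section \<open>Vertical lines meeting infinitely many discs\<close>

lemma vertical_line_meets_ball_iff:
  "vertical_line c \<inter> ball u r \<noteq> {} \<longleftrightarrow> \<bar>c - Re u\<bar> < r"
proof
  assume "vertical_line c \<inter> ball u r \<noteq> {}"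
  then obtain v where "v \<in> vertical_line c" "v \<in> ball u r"
    by blast
  then have "Re v = c" "cmod (v - u) < r"
    by (simp_all add: vertical_line_def dist_norm norm_minus_commute)
  then show "\<bar>c - Re u\<bar> < r"
    using abs_Re_le_cmod[of "v - u"] by simp
next
  assume "\<bar>c - Re u\<bar> < r"
  moreover have "Complex c (Im u) - u = of_real (c - Re u)"
    by (simp add: complex_eq_iff)
  then have "dist u (Complex c (Im u)) = \<bar>c - Re u\<bar>"
    by (metis dist_commute dist_norm norm_of_real)
  ultimately have "Complex c (Im u) \<in> vertical_line c \<inter> ball u r"
    by (simp add: vertical_line_def)
  then show "vertical_line c \<inter> ball u r \<noteq> {}" by blast
qed

lemma null_set_of_lines_meeting_infinitely_many_balls:
  fixes u :: "nat \<Rightarrow> complex"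
  assumes "summable r" and "\<And>m. 0 \<le> r m"
  shows "{c. infinite {m\<in>{1..}. vertical_line c \<inter> ball (u m) (r m) \<noteq> {}}} \<in> null_sets lebesgue"
proof (rule null_sets_completion_subset)
  define I where "I m = {Re (u m) - r m<..<Re (u m) + r m}" for m
  show "limsup I \<in> null_sets lebesgue"
  proof (rule borel_cantelli_limsup1)
    have "measure lebesgue (I m) = 2 * r m" for m
      using assms(2)[of m] by (simp add: I_def)
    then show "summable (\<lambda>m. measure lebesgue (I m))"
      using assms(1) by (simp add: summable_mult)
    show "emeasure lebesgue (I m) < \<infinity>" for m
      using assms(2)[of m] by (simp add: I_def)
  qed (simp add: I_def)
  show "{c. infinite {m\<in>{1..}. vertical_line c \<inter> ball (u m) (r m) \<noteq> {}}} \<subseteq> limsup I"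
  proof
    fix c
    assume "c \<in> {c. infinite {m\<in>{1..}. vertical_line c \<inter> ball (u m) (r m) \<noteq> {}}}"
    moreover have "{m\<in>{1..}. vertical_line c \<inter> ball (u m) (r m) \<noteq> {}} \<subseteq> {m. c \<in> I m}"
      by (auto simp: vertical_line_meets_ball_iff I_def abs_less_iff)
    ultimately have "infinite {m. c \<in> I m}" using finite_subset by blast
    then show "c \<in> limsup I"
      unfolding mem_limsup_iff by (simp add: frequently_cofinite flip: cofinite_eq_sequentially)
  qed
qed

theorem mainTheorem2:
  fixes n :: nat and w :: "nat \<Rightarrow> real" and H :: "nat \<Rightarrow> complex" and z :: "nat \<Rightarrow> complex"
  assumes "n \<ge> 2"
    and "0 < w 1"
    and "strict_mono_on {1..n} w"
    and "\<And>k. k \<in> {1..n} \<Longrightarrow> H k \<noteq> 0"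
    and "zero_sequence (exp_sum n H w) z"
  shows "{c :: real. infinite {m\<in>{1..}. vertical_line c \<inter> zero_disc z m \<noteq> {}}} \<in> null_sets lebesgue"
proof -
  have w: "w 1 \<le> w k" "w k \<le> w n" if "k \<in> {1..n}" for k
    using strict_mono_on_leD[OF assms(3), of 1 k] strict_mono_on_leD[OF assms(3), of k n] that
    by auto
  have w_pos: "w k > 0" if "k \<in> {1..n}" for k
    using w(1)[OF that] assms(2) by linarith
  \<comment> \<open>All frequencies are positive, so far to the left the constant term 1 dominates; this gives a
    centre for the zero count even when \<open>0\<close> is a zero.\<close>
  have "eventually (\<lambda>x. exp_sum n H w (of_real x) \<noteq> 0) at_bot"
    by (rule tendsto_imp_eventually_ne[OF exp_sum_tendsto_1[OF w_pos]]) simp_all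
  then obtain x :: real where x: "exp_sum n H w (of_real x) \<noteq> 0"
    using eventually_happens' trivial_limit_at_bot_linorder by blast
  have wn: "w n > 0" using w_pos[of n] assms(1) by simp
  have type: "cmod (exp_sum n H w u) \<le> (1 + (\<Sum>k=1..n. cmod (H k))) * exp (w n * cmod u)" for u
  proof (rule exp_sum_exponential_type)
    show "\<bar>w k\<bar> \<le> w n" if "k \<in> {1..n}" for k
      using w(2)[OF that] w_pos[OF that] by linarith
  qed (use wn in simp)
  obtain c where c: "c > 0" "eventually (\<lambda>m. c * real m \<le> cmod (z m)) sequentially"
    using linear_growth_of_zeros[OF exp_sum_holomorphic assms(5) x type wn] by blast
  have "summable (\<lambda>m. disc_radius (z m))"
  proof (rule summable_comparison_test_ev[OF _ summable_disc_radius[OF c(1)]])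
    show "eventually (\<lambda>m. norm (disc_radius (z m)) \<le> disc_radius (of_real (c * real m))) sequentially"
      using c(2)
    proof eventually_elim
      case (elim m)
      then show ?case
        using c(1) disc_radius_nonneg[of "z m"]
        by (simp add: disc_radius_antimono norm_mult)
    qed
  qed
  then show ?thesis
    unfolding zero_disc_def
    by (rule null_set_of_lines_meeting_infinitely_many_balls) (rule disc_radius_nonneg)
qed

end
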